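(* For all integers $k_1,k_2\geq1$ with $k:=k_1+k_2\geq4$ even, the following holds in $\mathcal{E}_k$: \[ \begin{aligned} \frac12\left(\binom{k_1+k_2}{k_2}-(-1)^{k_1}\right)G\begin{bmatrix}k\\0\end{bmatrix}=\;&\sum_{\substack{j=2\\ j\text{ even}}}^{k-2}\left(\binom{k-j-1}{k_1-1}+\binom{k-j-1}{k_2-1}-\delta_{j,k_1}\right)P\begin{bmatrix}j,k-j\\0,0\end{bmatrix}\\ &+\frac12\left(\binom{k-3}{k_1-1}+\binom{k-3}{k_2-1}+\delta_{k_1,1}+\delta_{k_2,1}\right)G\begin{bmatrix}k-1\\1\end{bmatrix}. \end{aligned} \]
   Context: Formal double Eisenstein space $\mathcal{E}_K$ ($K\geq1$): the $\mathbb{Q}$-vector space spanned by formal symbols $G\begin{bmatrix}k\\ d\end{bmatrix}$ ($k\geq1,d\geq0,k+d=K$), $G\begin{bmatrix}k_1,k_2\\ d_1,d_2\end{bmatrix}$, $P\begin{bmatrix}k_1,k_2\\ d_1,d_2\end{bmatrix}$ ($k_i\geq1,d_i\geq0$, $k_1+k_2+d_1+d_2=K$) modulo the relations, for all such indices: $P\begin{bmatrix}k_1,k_2\\ d_1,d_2\end{bmatrix}=G\begin{bmatrix}k_1,k_2\\ d_1,d_2\end{bmatrix}+G\begin{bmatrix}k_2,k_1\\ d_2,d_1\end{bmatrix}+G\begin{bmatrix}k_1+k_2\\ d_1+d_2\end{bmatrix}=\sum_{\substack{l_1+l_2=k_1+k_2,\ e_1+e_2=d_1+d_2\\ l_i\geq1,\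 e_i\geq0}}\left(\binom{l_1-1}{k_1-1}\binom{d_1}{e_1}(-1)^{d_1-e_1}+\binom{l_1-1}{k_2-1}\binom{d_2}{e_1}(-1)^{d_2-e_1}\right)G\begin{bmatrix}l_1,l_2\\ e_1,e_2\end{bmatrix}+\frac{d_1!d_2!}{(d_1+d_2+1)!}\binom{k_1+k_2-2}{k_1-1}G\begin{bmatrix}k_1+k_2-1\\ d_1+d_2+1\end{bmatrix}$. $\delta$ is the Kronecker delta. *)

theory Defs
  imports Complex_Main "HOL-Library.Poly_Mapping" "HOL-Library.Set_Algebras"
begin

(* The upper row (k or k_1, k_2) comes first in the arguments, then the lower row (d or d_1, d_2).
   Index tuples that are not admissible (some k_i = 0) exist in the datatype, but they are
   excluded from every set below. *)
datatype eis_symbol =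
    SymG nat nat
  | SymGG nat nat nat nat
  | SymPP nat nat nat nat

definition eis_symbols :: "nat \<Rightarrow> eis_symbol set" where
  "eis_symbols K =
     {SymG k d | k d. k \<ge> 1 \<and> k + d = K}
   \<union> {SymGG k1 k2 d1 d2 | k1 k2 d1 d2. k1 \<ge> 1 \<and> k2 \<ge> 1 \<and> k1 + k2 + d1 + d2 = K}
   \<union> {SymPP k1 k2 d1 d2 | k1 k2 d1 d2. k1 \<ge> 1 \<and> k2 \<ge> 1 \<and> k1 + k2 + d1 + d2 = K}"

type_synonym eis_comb = "eis_symbol \<Rightarrow>\<^sub>0 rat"

definition qscale :: "rat \<Rightarrow> eis_comb \<Rightarrow> eis_comb" (infixr "*\<^sub>Q" 75) where
  "c *\<^sub>Q x = Poly_Mapping.map ((*) c) x"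

lemma lookup_qscale [simp]: "Poly_Mapping.lookup (c *\<^sub>Q x) s = c * Poly_Mapping.lookup x s"
  by (simp add: qscale_def Poly_Mapping.map.rep_eq when_def)

global_interpretation eis: vector_space qscale
  by unfold_locales (rule poly_mapping_eqI, simp add: lookup_add algebra_simps)+

definition G1 :: "nat \<Rightarrow> nat \<Rightarrow> eis_comb" where
  "G1 k d = Poly_Mapping.single (SymG k d) 1"

definition G2 :: "nat \<Rightarrow> nat \<Rightarrow> nat \<Rightarrow> nat \<Rightarrow> eis_comb" where
  "G2 k1 k2 d1 d2 = Poly_Mapping.single (SymGG k1 k2 d1 d2) 1"

definition P2 :: "nat \<Rightarrow> nat \<Rightarrow> nat \<Rightarrow> nat \<Rightarrow> eis_comb" where
  "P2 k1 k2 d1 d2 = Poly_Mapping.single (SymPP k1 k2 d1 d2) 1"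

definition eis_free :: "nat \<Rightarrow> eis_comb set" where
  "eis_free K = eis.span ((\<lambda>s. Poly_Mapping.single s 1) ` eis_symbols K)"

definition stuffle_rhs :: "nat \<Rightarrow> nat \<Rightarrow> nat \<Rightarrow> nat \<Rightarrow> eis_comb" where
  "stuffle_rhs k1 k2 d1 d2 = G2 k1 k2 d1 d2 + G2 k2 k1 d2 d1 + G1 (k1 + k2) (d1 + d2)"

(* Here l_2 = k_1 + k_2 - l_1 and e_2 = d_1 + d_2 - e_1. The subtractions in the exponents of -1
   truncate only where the neighbouring binomial coefficient vanishes. *)
definition shuffle_rhs :: "nat \<Rightarrow> nat \<Rightarrow> nat \<Rightarrow> nat \<Rightarrow> eis_comb" where
  "shuffle_rhs k1 k2 d1 d2 =
     (\<Sum>l1 = 1..k1 + k2 - 1. \<Sum>e1 = 0..d1 + d2.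
        (of_nat ((l1 - 1) choose (k1 - 1)) * of_nat (d1 choose e1) * (- 1) ^ (d1 - e1)
         + of_nat ((l1 - 1) choose (k2 - 1)) * of_nat (d2 choose e1) * (- 1) ^ (d2 - e1))
        *\<^sub>Q G2 l1 (k1 + k2 - l1) e1 (d1 + d2 - e1))
     + (fact d1 * fact d2 / fact (d1 + d2 + 1) * of_nat ((k1 + k2 - 2) choose (k1 - 1)))
        *\<^sub>Q G1 (k1 + k2 - 1) (d1 + d2 + 1)"

definition eis_relators :: "nat \<Rightarrow> eis_comb set" where
  "eis_relators K =
     {P2 k1 k2 d1 d2 - stuffle_rhs k1 k2 d1 d2 | k1 k2 d1 d2.
        k1 \<ge> 1 \<and> k2 \<ge> 1 \<and> k1 + k2 + d1 + d2 = K}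
   \<union> {P2 k1 k2 d1 d2 - shuffle_rhs k1 k2 d1 d2 | k1 k2 d1 d2.
        k1 \<ge> 1 \<and> k2 \<ge> 1 \<and> k1 + k2 + d1 + d2 = K}"

(* The class of x is the coset x + W, where W is the subspace spanned by the relators. *)
definition eis_class :: "nat \<Rightarrow> eis_comb \<Rightarrow> eis_comb set" where
  "eis_class K x = x +o eis.span (eis_relators K)"

definition eis_space :: "nat \<Rightarrow> eis_comb set set" where
  "eis_space K = eis_class K ` eis_free K"

lemma eis_class_eq_iff: "eis_class K x = eis_class K y \<longleftrightarrow> x - y \<in> eis.span (eis_relators K)"
proof
  assume *: "eis_class K x = eis_class K y"
  have "x \<in> eis_class K x"
    unfolding eis_class_def elt_set_plus_def using eis.span_zero by force
  with * obtain w where w: "w \<in> eis.span (eis_relators K)" "x = y + w"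
    by (auto simp: eis_class_def elt_set_plus_def)
  then show "x - y \<in> eis.span (eis_relators K)" by simp
next
  assume *: "x - y \<in> eis.span (eis_relators K)"
  show "eis_class K x = eis_class K y"
    unfolding eis_class_def elt_set_plus_def
  proof (intro set_eqI iffI; clarsimp)
    fix w assume w: "w \<in> eis.span (eis_relators K)"
    show "\<exists>v\<in>eis.span (eis_relators K). x + w = y + v"
      by (rule bexI [OF _ eis.span_add [OF * w]]) simp
    show "\<exists>v\<in>eis.span (eis_relators K). y + w = x + v"
      by (rule bexI [OF _ eis.span_diff [OF w *]]) simp
  qed
qed

lemma eis_relators_subset: "eis_relators K \<subseteq> eis_free K"
proof -
  have G1: "G1 k d \<in> eis_free K" if "k \<ge> 1" "k + d = K" for k d
    using that unfolding eis_free_def G1_def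
    by (intro eis.span_base imageI) (auto simp: eis_symbols_def)
  have G2: "G2 k1 k2 d1 d2 \<in> eis_free K"
    if "k1 \<ge> 1" "k2 \<ge> 1" "k1 + k2 + d1 + d2 = K" for k1 k2 d1 d2
    using that unfolding eis_free_def G2_def
    by (intro eis.span_base imageI) (auto simp: eis_symbols_def)
  have P2: "P2 k1 k2 d1 d2 \<in> eis_free K"
    if "k1 \<ge> 1" "k2 \<ge> 1" "k1 + k2 + d1 + d2 = K" for k1 k2 d1 d2
    using that unfolding eis_free_def P2_def
    by (intro eis.span_base imageI) (auto simp: eis_symbols_def)
  have sub: "eis.subspace (eis_free K)"
    unfolding eis_free_def by (rule eis.subspace_span)
  note closed = eis.subspace_diff [OF sub] eis.subspace_add [OF sub]
    eis.subspace_scale [OF sub] eis.subspace_sum [OF sub]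
  have stuffle: "stuffle_rhs k1 k2 d1 d2 \<in> eis_free K"
    if "k1 \<ge> 1" "k2 \<ge> 1" "k1 + k2 + d1 + d2 = K" for k1 k2 d1 d2
  proof -
    have "G2 k1 k2 d1 d2 \<in> eis_free K" "G2 k2 k1 d2 d1 \<in> eis_free K"
      "G1 (k1 + k2) (d1 + d2) \<in> eis_free K"
      using that by (simp_all add: G1 G2)
    then show ?thesis
      unfolding stuffle_rhs_def by (intro closed)
  qed
  have shuffle: "shuffle_rhs k1 k2 d1 d2 \<in> eis_free K"
    if "k1 \<ge> 1" "k2 \<ge> 1" "k1 + k2 + d1 + d2 = K" for k1 k2 d1 d2
  proof -
    have "G2 l1 (k1 + k2 - l1) e1 (d1 + d2 - e1) \<in> eis_free K"
      if l1: "l1 \<in> {1..k1 + k2 - 1}" and e1: "e1 \<in> {0..d1 + d2}" for l1 e1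
    proof (rule G2)
      have "l1 \<ge> 1" "l1 < k1 + k2" "e1 \<le> d1 + d2"
        using l1 e1 \<open>k1 \<ge> 1\<close> by auto
      then show "l1 \<ge> 1" "k1 + k2 - l1 \<ge> 1" "l1 + (k1 + k2 - l1) + e1 + (d1 + d2 - e1) = K"
        using \<open>k1 + k2 + d1 + d2 = K\<close> by linarith+
    qed
    moreover have "G1 (k1 + k2 - 1) (d1 + d2 + 1) \<in> eis_free K"
      by (rule G1) (use that in linarith)+
    ultimately show ?thesis
      unfolding shuffle_rhs_def by (intro closed)
  qed
  show ?thesis
    unfolding eis_relators_def using P2 stuffle shuffle eis.subspace_diff [OF sub] by blast
qed

end

(* Modulo the relations with d_1 = d_2 = 0, homogeneous generating polynomials g and p of the
   symbols G[r,s;0,0] and P[r,s;0,0] (with X^(r-1) Y^(s-1)) satisfy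
     p(X,Y) = g(X,Y) + g(Y,X) + G[k;0] h(X,Y) = g(X+Y,Y) + g(X+Y,X) + G[k-1;1] (X+Y)^(k-2),
   where h is the sum of all monomials of degree k-2. Rewriting p(X+Y,Y), p(X+Y,X), p(-X,Y) by
   the first equality and p(-X-Y,Y), p(-X-Y,X), p(X,Y) by the second one, all values of g cancel
   in the part of p(X+Y,Y) + p(X+Y,X) - p(X,Y) that is odd in the first argument of p. Comparing
   coefficients gives the theorem. To work with numbers instead of classes, apply an arbitrary
   linear functional that vanishes on the relators. *)
theory Submission
  imports Defs "HOL-Computational_Algebra.Polynomial"
begin

section \<open>Binary forms and linear substitutions\<close>

text \<open>A binary form is handled through its values, so that a substitution such as (x + y, y)
  is a mere change of arguments; \<open>hom_poly_eq_0_imp\<close> later recovers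
  coefficients.\<close>

definition hom_poly :: "nat \<Rightarrow> (nat \<Rightarrow> 'a) \<Rightarrow> 'a \<Rightarrow> 'a \<Rightarrow> 'a::comm_ring_1" where
  "hom_poly n c x y = (\<Sum>i\<le>n. c i * x ^ i * y ^ (n - i))"

lemma hom_poly_cong:
  "(\<And>i. i \<le> n \<Longrightarrow> c i = d i) \<Longrightarrow> hom_poly n c x y = hom_poly n d x y"
  by (simp add: hom_poly_def)

lemma hom_poly_add: "hom_poly n (\<lambda>i. c i + d i) x y = hom_poly n c x y + hom_poly n d x y"
  by (simp add: hom_poly_def algebra_simps sum.distrib)

lemma hom_poly_diff: "hom_poly n (\<lambda>i. c i - d i) x y = hom_poly n c x y - hom_poly n d x y"
  by (simp add: hom_poly_def algebra_simps sum_subtractf)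

lemma hom_poly_mult: "hom_poly n (\<lambda>i. a * c i) x y = a * hom_poly n c x y"
  by (simp add: hom_poly_def algebra_simps sum_distrib_left)

lemma hom_poly_reflect: "hom_poly n (\<lambda>i. c (n - i)) x y = hom_poly n c y x"
  unfolding hom_poly_def
  by (rule sum.reindex_bij_witness[of _ "\<lambda>i. n - i" "\<lambda>i. n - i"]) (auto simp: mult_ac)

lemma hom_poly_alternate: "hom_poly n (\<lambda>i. (- 1) ^ i * c i) x y = hom_poly n c (- x) y"
  by (simp add: hom_poly_def power_minus[of x] mult_ac)

lemma hom_poly_minus_minus:
  assumes "even n"
  shows "hom_poly n c (- x) (- y) = hom_poly n c x y"
  unfolding hom_poly_def
proof (rule sum.cong)
  fix i assume "i \<in> {..n}"
  then have "(- 1 :: 'a) ^ i * (- 1) ^ (n - i) = 1"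
    using assms by (simp flip: power_add)
  then show "c i * (- x) ^ i * (- y) ^ (n - i) = c i * x ^ i * y ^ (n - i)"
    unfolding power_minus[of x] power_minus[of y] by (simp add: algebra_simps)
qed simp

lemma hom_poly_choose:
  assumes "l \<le> n"
  shows "hom_poly n (\<lambda>i. of_nat (l choose i)) x y = (x + y) ^ l * y ^ (n - l)"
proof -
  have "hom_poly n (\<lambda>i. of_nat (l choose i)) x y
      = (\<Sum>i\<le>l. of_nat (l choose i) * x ^ i * y ^ (n - i))"
    unfolding hom_poly_def using assms
    by (intro sum.mono_neutral_right) (auto simp: binomial_eq_0)
  also have "\<dots> = (\<Sum>i\<le>l. of_nat (l choose i) * x ^ i * y ^ (l - i) * y ^ (n - l))"
    using assms by (intro sum.cong) (auto simp: mult.assoc simp flip: power_add)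
  finally show ?thesis
    by (simp add: binomial_ring sum_distrib_right)
qed

text \<open>This is the source of the shuffle binomials: replacing x by x + y expands each monomial
  by the binomial theorem.\<close>

lemma hom_poly_binomial_transform:
  "hom_poly n (\<lambda>i. \<Sum>l\<le>n. of_nat (l choose i) * c l) x y = hom_poly n c (x + y) y"
proof -
  have "hom_poly n (\<lambda>i. \<Sum>l\<le>n. of_nat (l choose i) * c l) x y
      = (\<Sum>l\<le>n. c l * hom_poly n (\<lambda>i. of_nat (l choose i)) x y)"
    unfolding hom_poly_def sum_distrib_left sum_distrib_right
    by (subst sum.swap) (simp add: mult_ac)
  also have "\<dots> = hom_poly n c (x + y) y"
    unfolding hom_poly_def[of n c] by (intro sum.cong) (auto simp: hom_poly_choose mult_ac)
  finally show ?thesis .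
qed

text \<open>Setting y = 1 leaves an ordinary polynomial, and in characteristic 0 only the zero
  polynomial vanishes everywhere.\<close>

lemma hom_poly_eq_0_imp:
  fixes c :: "nat \<Rightarrow> 'a::{idom,ring_char_0}"
  assumes "\<And>x. hom_poly n c x 1 = 0" and "m \<le> n"
  shows "c m = 0"
proof -
  define p where "p = (\<Sum>i\<le>n. monom (c i) i)"
  have "poly p x = 0" for x
    using assms(1)[of x] by (simp add: p_def poly_sum poly_monom hom_poly_def)
  then have "p = 0"
    using poly_all_0_iff_0 by blast
  moreover have "coeff p m = c m"
    using assms(2) by (simp add: p_def coeff_sum)
  ultimately show ?thesis by simp
qed

section \<open>Elimination of the double symbols G\<close>

text \<open>Upper indices are shifted by one: n = k - 2, m = k_1 - 1, and i stands for j - 1. The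
  numbers \<open>a\<close> and \<open>b\<close> are the values of G[k;0] and G[k-1;1]. The factor
  \<open>1 - (- 1) ^ i\<close> is 2 for odd i and 0 otherwise, so it keeps exactly the even
  j.\<close>

lemma even_double_shuffle:
  fixes p g :: "nat \<Rightarrow> 'a::{idom,ring_char_0}"
  assumes n: "even n"
    and stuffle: "\<And>i. i \<le> n \<Longrightarrow> p i = g i + g (n - i) + a"
    and shuffle: "\<And>i. i \<le> n \<Longrightarrow> p i =
      (\<Sum>l\<le>n. (of_nat (l choose i) + of_nat (l choose (n - i))) * g l) + of_nat (n choose i) * b"
    and m: "m \<le> n"
  shows "(\<Sum>i\<le>n. (1 - (- 1) ^ i) * p i
             * (of_nat ((n - i) choose m) + of_nat ((n - i) choose (n - m))))
           - (1 - (- 1) ^ m) * p m + (of_nat (n choose m) + of_bool (m = 0) + of_bool (m = n)) * b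
         = (of_nat ((n + 2) choose (m + 1)) + (- 1) ^ m) * a"
proof -
  define H :: "(nat \<Rightarrow> 'a) \<Rightarrow> 'a \<Rightarrow> 'a \<Rightarrow> 'a" where "H = hom_poly n"
  \<comment> \<open>Twice the part of \<open>p\<close> that is odd in the first argument.\<close>
  define q where "q i = p i - (- 1) ^ i * p i" for i
  define T where "T c i = (\<Sum>l\<le>n. of_nat (l choose i) * c l)" for c :: "nat \<Rightarrow> 'a" and i
  define h where "h = H (\<lambda>_. 1)"
  have T: "H (T c) x y = H c (x + y) y" for c x y
    unfolding H_def T_def by (rule hom_poly_binomial_transform)
  have T': "H (\<lambda>i. T c (n - i)) x y = H c (x + y) x" for c x y
    unfolding H_def hom_poly_reflect[of n "T c"] using T[of c y x] by (simp add: H_def add.commute)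
  have choose: "H (\<lambda>i. of_nat (n choose i)) x y = (x + y) ^ n" for x y
    by (simp add: H_def hom_poly_choose)
  have st: "H p x y = H g x y + H g y x + a * h x y" for x y
  proof -
    have "H p x y = H (\<lambda>i. g i + g (n - i) + a * 1) x y"
      unfolding H_def by (rule hom_poly_cong) (simp add: stuffle)
    then show ?thesis
      by (simp only: H_def h_def hom_poly_add hom_poly_mult hom_poly_reflect)
  qed
  have sh: "H p x y = H g (x + y) y + H g (x + y) x + b * (x + y) ^ n" for x y
  proof -
    have "H p x y = H (\<lambda>i. T g i + T g (n - i) + b * of_nat (n choose i)) x y"
      unfolding H_def
      by (rule hom_poly_cong) (simp add: shuffle T_def distrib_left sum.distrib mult.commute)
    also have "\<dots> = H (T g) x y + H (\<lambda>i. T g (n - i)) x y + b * H (\<lambda>i. of_nat (n choose i)) x y"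
      by (simp only: H_def hom_poly_add hom_poly_mult)
    finally show ?thesis
      by (simp only: T T' choose)
  qed
  have q: "H q x y = H p x y - H p (- x) y" for x y
    unfolding q_def H_def by (simp only: hom_poly_diff hom_poly_alternate)
  have neg: "H c (- x) (- y) = H c x y" for c x y
    unfolding H_def by (rule hom_poly_minus_minus[OF n])
  have neg': "H c x (- y) = H c (- x) y" for c x y
    using neg[of c x "- y"] by simp

  have key: "H q (x + y) y + H q (x + y) x - H q x y + b * ((x + y) ^ n + x ^ n + y ^ n)
      = a * (h (x + y) y + h (x + y) x + h (- x) y)" for x y
  proof -
    \<comment> \<open>The shuffle sum of arguments -(x + y) + y collapses to -x; evenness of n then
      turns g(-x, -(x + y)) into g(x, x + y), which also occurs in the stuffle expansion of p(x + y,
      x).\<close>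
    have 1: "H p (- (x + y)) y = H g (- x) y + H g x (x + y) + b * x ^ n"
      using sh[of "- (x + y)" y] n neg[of g x "x + y"] by (simp add: algebra_simps)
    have 2: "H p (- (x + y)) x = H g (- y) x + H g y (x + y) + b * y ^ n"
      using sh[of "- (x + y)" x] n neg[of g y "x + y"] by (simp add: algebra_simps)
    have 3: "H p (- x) y = H g (- x) y + H g (- y) x + a * h (- x) y"
      using st[of "- x" y] by (simp add: neg')
    show ?thesis
      unfolding q 1 2 3 st[of "x + y"] sh[of x y] by (simp add: algebra_simps)
  qed

  \<comment> \<open>Coefficient sequence of the difference of the two sides of \<open>key\<close>;
    the \<open>of_bool\<close> terms come from x^n and y^n.\<close>
  define D where "D i = T q i + T q (n - i) - q i
      + b * (of_nat (n choose i) + of_bool (i = n) + of_bool (i = 0))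
      - a * (T (\<lambda>_. 1) i + T (\<lambda>_. 1) (n - i) + (- 1) ^ i * 1)" for i
  have "H D x y = 0" for x y
  proof -
    have top: "H (\<lambda>i. of_bool (i = n)) x y = x ^ n"
      by (simp add: H_def hom_poly_def of_bool_def if_distrib[of "\<lambda>u. u * _"] cong: if_cong)
    have bot: "H (\<lambda>i. of_bool (i = 0)) x y = y ^ n"
      by (simp add: H_def hom_poly_def of_bool_def if_distrib[of "\<lambda>u. u * _"] cong: if_cong)
    have "H D x y = H (T q) x y + H (\<lambda>i. T q (n - i)) x y - H q x y
      + b * (H (\<lambda>i. of_nat (n choose i)) x y + H (\<lambda>i. of_bool (i = n)) x y + H (\<lambda>i. of_bool (i = 0)) x y)
      - a * (H (T (\<lambda>_. 1)) x y + H (\<lambda>i. T (\<lambda>_. 1) (n - i)) x y + H (\<lambda>_. 1) (- x) y)"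
      unfolding D_def H_def by (simp only: hom_poly_add hom_poly_diff hom_poly_mult hom_poly_alternate)
    also have "\<dots> = 0"
      unfolding T T' choose top bot using key[of x y] by (simp add: h_def)
    finally show ?thesis .
  qed
  then have "D m = 0"
    unfolding H_def using m by (rule hom_poly_eq_0_imp)
  \<comment> \<open>The hockey-stick identity evaluates each sum; symmetry and Pascal's rule merge
    the two results.\<close>
  moreover have "T (\<lambda>_. 1) m + T (\<lambda>_. 1) (n - m) = of_nat ((n + 2) choose (m + 1))"
  proof -
    have hockey: "T (\<lambda>_. 1) i = of_nat (Suc n choose Suc i)" for i
      using sum_choose_upper[of i n]
      by (simp add: T_def atLeast0AtMost flip: of_nat_sum del: binomial_Suc_Suc)
    have "Suc n choose Suc (n - m) = Suc n choose m"
      using binomial_symmetric[of m "Suc n"] m by (simp add: Suc_diff_le)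
    then show ?thesis
      by (simp add: hockey flip: of_nat_add)
  qed
  moreover have "(\<Sum>i\<le>n. (1 - (- 1) ^ i) * p i
             * (of_nat ((n - i) choose m) + of_nat ((n - i) choose (n - m))))
       = T q m + T q (n - m)"
  proof -
    \<comment> \<open>The stuffle side is symmetric under i -> n - i, and n - i has the parity of
      i.\<close>
    have q_sym: "q (n - i) = (1 - (- 1) ^ i) * p i" if "i \<le> n" for i
      using that n by (simp add: q_def stuffle left_diff_distrib minus_one_power_iff add_ac)
    have "T q m + T q (n - m)
        = (\<Sum>l\<le>n. q l * (of_nat (l choose m) + of_nat (l choose (n - m))))"
      by (simp add: T_def distrib_left sum.distrib mult_ac)
    also have "\<dots> = (\<Sum>i\<le>n. q (n - i) * (of_nat ((n - i) choose m) + of_nat ((n - i) choose (n - m))))"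
      by (rule sum.reindex_bij_witness[of _ "\<lambda>i. n - i" "\<lambda>i. n - i"]) auto
    finally show ?thesis
      by (simp add: q_sym)
  qed
  ultimately show ?thesis
    unfolding D_def q_def by (simp add: algebra_simps)
qed

section \<open>Membership in a span, tested by functionals\<close>

text \<open>If v were outside the span, adding it to a basis B of the span would keep independence,
  and the functional that is 1 at v and 0 on B would contradict the assumption.\<close>

lemma (in vector_space) in_span_if_functionals_vanish:
  assumes "\<And>f. \<lbrakk>Vector_Spaces.linear scale (*) f; \<And>s. s \<in> S \<Longrightarrow> f s = 0\<rbrakk> \<Longrightarrow> f v = 0"
  shows "v \<in> span S"
proof (rule ccontr)
  assume v: "v \<notin> span S"
  interpret pair: vector_space_pair scale "(*)"
    by unfold_locales (auto simp: algebra_simps)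
  obtain B where B: "B \<subseteq> S" "independent B" "S \<subseteq> span B"
    using maximal_independent_subset by blast
  have span: "span B = span S"
    using B by (metis span_mono span_span subset_antisym span_minimal subspace_span)
  have "independent (insert v B)"
    using v B span by (simp add: independent_insert)
  from pair.linear_independent_extend[OF this, of "\<lambda>x. of_bool (x = v)"]
  obtain f where f: "Vector_Spaces.linear scale (*) f" "\<forall>x\<in>insert v B. f x = of_bool (x = v)"
    by blast
  have "v \<notin> B"
    using v span span_base by blast
  have "f s = 0" if "s \<in> S" for s
  proof (rule pair.linear_eq_0_on_span[OF f(1)])
    show "s \<in> span B" using that span span_base by blast
    show "\<And>x. x \<in> B \<Longrightarrow> f x = 0" using f(2) \<open>v \<notin> B\<close> by auto
  qed
  then have "f v = 0"
    using assms f(1) by blast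
  then show False
    using f(2) by simp
qed

section \<open>Transfer to the formal double Eisenstein space\<close>

theorem theorem4p4:
  fixes k1 k2 k :: nat
  assumes "k1 \<ge> 1" and "k2 \<ge> 1" and "k = k1 + k2" and "k \<ge> 4" and "even k"
  shows
    "eis_class k
       ((1 / 2 * (of_nat ((k1 + k2) choose k2) - (- 1) ^ k1)) *\<^sub>Q G1 k 0)
     = eis_class k
       ((\<Sum>j | j \<in> {2..k - 2} \<and> even j.
           (of_nat ((k - j - 1) choose (k1 - 1)) + of_nat ((k - j - 1) choose (k2 - 1))
            - of_bool (j = k1)) *\<^sub>Q P2 j (k - j) 0 0)
        + (1 / 2 * (of_nat ((k - 3) choose (k1 - 1)) + of_nat ((k - 3) choose (k2 - 1))
            + of_bool (k1 = 1) + of_bool (k2 = 1))) *\<^sub>Q G1 (k - 1) 1)"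
  unfolding eis_class_eq_iff
proof (rule eis.in_span_if_functionals_vanish)
  fix f :: "eis_comb \<Rightarrow> rat"
  assume lin: "Vector_Spaces.linear qscale (*) f"
    and vanish: "\<And>s. s \<in> eis_relators k \<Longrightarrow> f s = 0"
  interpret f: Vector_Spaces.linear qscale "(*)" f by (rule lin)
  define n m where "n = k - 2" and "m = k1 - 1"
  have k: "k = n + 2" "k1 = m + 1" "k2 = n - m + 1" and m: "m \<le> n" and n: "even n" "n \<ge> 2"
    using assms by (auto simp: n_def m_def)
  define g p where "g i = f (G2 (Suc i) (n - i + 1) 0 0)"
    and "p i = f (P2 (Suc i) (n - i + 1) 0 0)" for i
  define a b where "a = f (G1 k 0)" and "b = f (G1 (k - 1) 1)"
  have st: "p i = g i + g (n - i) + a" if "i \<le> n" for i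
  proof -
    have "f (P2 (Suc i) (n - i + 1) 0 0 - stuffle_rhs (Suc i) (n - i + 1) 0 0) = 0"
      using that k(1)
      by (intro vanish[unfolded eis_relators_def] UnI1 CollectI exI conjI refl) auto
    then show ?thesis
      using that k(1) by (simp add: stuffle_rhs_def f.diff f.add g_def p_def a_def)
  qed
  have sh: "p i = (\<Sum>l\<le>n. (of_nat (l choose i) + of_nat (l choose (n - i))) * g l)
      + of_nat (n choose i) * b" if "i \<le> n" for i
  proof -
    have "f (P2 (Suc i) (n - i + 1) 0 0 - shuffle_rhs (Suc i) (n - i + 1) 0 0) = 0"
      using that k(1)
      by (intro vanish[unfolded eis_relators_def] UnI2 CollectI exI conjI refl) auto
    \<comment> \<open>For d_1 = d_2 = 0 only e_1 = 0 remains, and the factorial quotient is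
      1.\<close>
    then have "p i = (\<Sum>l = 1..Suc n. (of_nat ((l - 1) choose i) + of_nat ((l - 1) choose (n - i)))
         * f (G2 l (n + 2 - l) 0 0)) + of_nat (n choose i) * b"
      using that k(1) by (simp add: shuffle_rhs_def f.diff f.add f.sum f.scale p_def b_def)
    also have "(\<Sum>l = 1..Suc n. (of_nat ((l - 1) choose i) + of_nat ((l - 1) choose (n - i)))
         * f (G2 l (n + 2 - l) 0 0))
       = (\<Sum>l\<le>n. (of_nat (l choose i) + of_nat (l choose (n - i))) * g l)"
      by (rule sum.reindex_bij_witness[of _ Suc "\<lambda>l. l - 1"]) (auto simp: g_def Suc_diff_le)
    finally show ?thesis .
  qed
  define A where "A i = (of_nat ((n - i) choose m) + of_nat ((n - i) choose (n - m)) :: rat)" for i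
  have sum_even: "(\<Sum>j | j \<in> {2..k - 2} \<and> even j.
        (of_nat ((k - j - 1) choose (k1 - 1)) + of_nat ((k - j - 1) choose (k2 - 1))
          - of_bool (j = k1)) * f (P2 j (k - j) 0 0))
      = (\<Sum>i\<le>n. (1 - (- 1) ^ i) / 2 * p i * (A i - of_bool (i = m)))"
  proof -
    \<comment> \<open>Half of the sign factor is the indicator of odd i. Since n is even, i = n
      drops out, so j = i + 1 stays at most n = k - 2.\<close>
    have "(\<Sum>i\<le>n. (1 - (- 1) ^ i) / 2 * p i * (A i - of_bool (i = m)))
        = (\<Sum>i | i \<le> n \<and> odd i. (A i - of_bool (i = m)) * p i)"
      by (rule sum.mono_neutral_cong_right) auto
    also have "\<dots> = (\<Sum>j | j \<in> {2..k - 2} \<and> even j.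
        (of_nat ((k - j - 1) choose (k1 - 1)) + of_nat ((k - j - 1) choose (k2 - 1))
          - of_bool (j = k1)) * f (P2 j (k - j) 0 0))"
    proof (rule sum.reindex_bij_witness[of _ "\<lambda>j. j - 1" Suc])
      fix i assume i: "i \<in> {i. i \<le> n \<and> odd i}"
      then show "Suc i \<in> {j. j \<in> {2..k - 2} \<and> even j}"
        using n(1) k(1) by (cases "i = n") (auto simp: Suc_le_eq odd_pos)
      from i show "(of_nat ((k - Suc i - 1) choose (k1 - 1)) + of_nat ((k - Suc i - 1) choose (k2 - 1))
          - of_bool (Suc i = k1)) * f (P2 (Suc i) (k - Suc i) 0 0) = (A i - of_bool (i = m)) * p i"
        by (simp add: k A_def p_def Suc_diff_le)
    qed (use k(1) in auto)
    finally show ?thesis ..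
  qed
  define S where "S = (\<Sum>i\<le>n. (1 - (- 1) ^ i) / 2 * p i * (A i - of_bool (i = m)))"
  have "2 * S = (\<Sum>i\<le>n. (1 - (- 1) ^ i) * p i * A i) - (1 - (- 1) ^ m) * p m"
  proof -
    have half: "2 * (u / 2 * v * w) = u * v * w" for u v w :: rat
      by simp
    \<comment> \<open>The Kronecker delta contributes only at i = m and splits off as the separate
      \<open>p m\<close> term.\<close>
    have "2 * S = (\<Sum>i\<le>n. (1 - (- 1) ^ i) * p i * A i - (if i = m then (1 - (- 1) ^ i) * p i else 0))"
      unfolding S_def sum_distrib_left half by (rule sum.cong) (auto simp: right_diff_distrib)
    then show ?thesis
      using m by (simp add: sum_subtractf)
  qed
  also have "\<dots> = (of_nat ((n + 2) choose (m + 1)) + (- 1) ^ m) * a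
      - (of_nat (n choose m) + of_bool (m = 0) + of_bool (m = n)) * b"
    unfolding A_def using even_double_shuffle[OF n(1) st sh m] by (simp only: eq_diff_eq)
  \<comment> \<open>Pascal's rule and symmetry produce the two binomials with upper entry k - 3 = n
    - 1.\<close>
  also have "n choose m = ((n - 1) choose m) + ((n - 1) choose (n - m))"
  proof (cases m)
    case 0
    then show ?thesis using n by simp
  next
    case (Suc m')
    then have "n - m \<le> n - 1" "n - 1 - (n - m) = m'"
      using m by auto
    then have "(n - 1) choose (n - m) = (n - 1) choose m'"
      using binomial_symmetric[of "n - m" "n - 1"] by simp
    then show ?thesis
      using n Suc by (cases n) auto
  qed
  finally have S: "2 * S = (of_nat ((n + 2) choose (m + 1)) + (- 1) ^ m) * a
      - (of_nat ((n - 1) choose m) + of_nat ((n - 1) choose (n - m)) + of_bool (m = 0) + of_bool (m = n)) * b"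
    by (simp only: of_nat_add)
  have idx: "(k1 + k2) choose k2 = (n + 2) choose (m + 1)"
  proof -
    have "(k1 + k2) choose k2 = (k1 + k2) choose k1"
      using binomial_symmetric[of k2 "k1 + k2"] by simp
    moreover have "k1 + k2 = n + 2"
      using k m by simp
    ultimately show ?thesis
      using k(2) by metis
  qed
  \<comment> \<open>The shift k_1 = m + 1 flips the sign, so the plus sign in \<open>S\<close>
    matches the minus sign in the theorem.\<close>
  have idx': "k1 = 1 \<longleftrightarrow> m = 0" "k2 = 1 \<longleftrightarrow> m = n" "k - 3 = n - 1" "k1 - 1 = m" "k2 - 1 = n - m"
    "(- 1 :: rat) ^ k1 = - ((- 1) ^ m)"
    using k m by auto
  show "f ((1 / 2 * (of_nat ((k1 + k2) choose k2) - (- 1) ^ k1)) *\<^sub>Q G1 k 0 -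
       ((\<Sum>j | j \<in> {2..k - 2} \<and> even j.
           (of_nat ((k - j - 1) choose (k1 - 1)) + of_nat ((k - j - 1) choose (k2 - 1))
            - of_bool (j = k1)) *\<^sub>Q P2 j (k - j) 0 0)
        + (1 / 2 * (of_nat ((k - 3) choose (k1 - 1)) + of_nat ((k - 3) choose (k2 - 1))
            + of_bool (k1 = 1) + of_bool (k2 = 1))) *\<^sub>Q G1 (k - 1) 1)) = 0"
    unfolding f.diff f.add f.sum f.scale sum_even a_def[symmetric] b_def[symmetric] S_def[symmetric]
    unfolding idx idx' using S by (simp only: minus_minus diff_minus_eq_add)
qed

end
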